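(* Let $\boldsymbol U_k\in\mathbb{R}^{N\times n}$ be a basis matrix (linearly independent columns) and $\boldsymbol P_k\in\mathbb{R}^{N\times n}$ an interpolation points matrix such that $\boldsymbol P_k^T\boldsymbol U_k$ is invertible. Let $\bar{\mathcal{U}}_{k+1}$ be an $n$-dimensional subspace of $\mathbb{R}^N$ and let $\boldsymbol F_k\in\mathbb{R}^{N\times w}$ have rank $n$, with columns in $\bar{\mathcal{U}}_{k+1}$, and such that $\boldsymbol P_k^T\boldsymbol F_k$ has rank $n$. Set $\boldsymbol C_k=(\boldsymbol P_k^T\boldsymbol U_k)^{-1}\boldsymbol P_k^T\boldsymbol F_k$ and $\boldsymbol R_k=\boldsymbol U_k\boldsymbol C_k-\boldsymbol F_k$. Let $j_1,\dots,j_N$ be an ordering of $\{1,\dots,N\}$ such that the component-wise residual decays as $$\|\boldsymbol R_k^T\boldsymbol e_{j_i}\|_2^2\le c_1\mathrm e^{-c_2 i^{a}},\qquad i=1,\dots,N,$$ with rate $a>1$ and constants $c_1,c_2>0$. Suppose that $m$ sampling points ($n<m\le N$) are selected by adaptive sampling from $\boldsymbol R_k$ and that $\mathcal{U}_{k+1}$ is the adapted space obtained with a full-rank ADEIM update. Then $$d(\bar{\mathcal{U}}_{k+1},\mathcal{U}_{k+1})\le c_3\,\mathrm e^{-c_2 m^{a}},\qquad c_3=\frac{c_1}{(1-\mathrm e^{-c_2})\,\sigma_{\min}^2(\boldsymbol F_k)},$$ where the constant $c_3$ is independent of $m$. In particular, for a threshold $\epsilon>0$, setting the number of sampling points to $$m\ge\min\left\{N,\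 \left(-\frac{1}{c_2}\log\left(\frac{\epsilon}{c_3}\right)\right)^{1/a}\right\}$$ guarantees $d(\bar{\mathcal{U}}_{k+1},\mathcal{U}_{k+1})\le\epsilon$.
   Context: Distance of subspaces: for $n$-dimensional subspaces $\mathcal{U},\bar{\mathcal{U}}$ of $\mathbb{R}^N$ with orthonormal basis matrices $\boldsymbol U,\bar{\boldsymbol U}\in\mathbb{R}^{N\times n}$, $d(\bar{\mathcal{U}},\mathcal{U})=\|\bar{\boldsymbol U}-\boldsymbol U\boldsymbol U^T\bar{\boldsymbol U}\|_F^2$; this is symmetric and independent of the choice of orthonormal bases. $\boldsymbol e_i\in\mathbb{R}^N$ is the $i$-th canonical unit vector. Interpolation and sampling points matrices: $\boldsymbol P_k=[\boldsymbol e_{p_1},\dots,\boldsymbol e_{p_n}]\in\mathbb{R}^{N\times n}$ with distinct interpolation points $p_1,\dots,p_n\in\{1,\dots,N\}$; $\boldsymbol S_k=[\boldsymbol e_{s_1},\dots,\boldsymbol e_{s_m}]\in\mathbb{R}^{N\times m}$ with distinct sampling points $s_1,\dots,s_m\in\{1,\dots,N\}$, $m>n$. Adaptive sampling: the sampling points are $m$ indices with the largest component-wise residuals $\|\boldsymbol R_k^T\boldsymbol e_i\|_2^2$, i.e., if $\ell_1,\dots,\ell_N$ is an ordering of $1,\dots,N$ with $\|\boldsymbol R_k^T\boldsymbol e_{\ell_1}\|_2^2\ge\dots\ge\|\boldsymbol R_k^T\boldsymbol e_{\ell_N}\|_2^2$, then $\boldsymbol S_k=[\boldsymbol e_{\ell_1},\dots,\boldsymbol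 e_{\ell_m}]$. ADEIM update of rank $r$: a matrix $\boldsymbol\alpha_k\boldsymbol\beta_k^T\in\mathbb{R}^{N\times n}$ with $\boldsymbol\alpha_k\in\mathbb{R}^{N\times r}$, $\boldsymbol\beta_k\in\mathbb{R}^{n\times r}$, whose rows with index not among the sampling points are zero, and that minimizes $\|\boldsymbol S_k^T((\boldsymbol U_k+\boldsymbol\alpha_k\boldsymbol\beta_k^T)\boldsymbol C_k-\boldsymbol F_k)\|_F^2$ among all such matrices. The adapted basis matrix is $\boldsymbol U_{k+1}=\boldsymbol U_k+\boldsymbol\alpha_k\boldsymbol\beta_k^T$ and the adapted space $\mathcal{U}_{k+1}$ is its column span. The update is full-rank if $r=\bar r$, where $\bar r$ is the rank of $\boldsymbol S_k^T\boldsymbol R_k$ (the zero update if $\bar r=0$). $\sigma_{\min}(\boldsymbol F_k)$ is the smallest non-zero singular value of $\boldsymbol F_k$. Convention: if $\epsilon>c_3$ (so that the base of the power is negative), the power is read as $0$, i.e., the condition on $m$ is void. *)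

theory Defs
  imports "HOL-Analysis.Analysis"
begin

text \<open>
  Throughout, \<open>norm\<close> of a matrix of type \<open>real ^ 'n ^ 'm\<close> is the Euclidean norm of the vector of
  Euclidean norms of its rows, i.e. the Frobenius norm.
\<close>

definition orthonormal_basis_matrix :: "real ^ 'n ^ 'N \<Rightarrow> (real ^ 'N) set \<Rightarrow> bool" where
  "orthonormal_basis_matrix U V \<longleftrightarrow> transpose U ** U = mat 1 \<and> span (columns U) = V"

text \<open>
  The type argument carries the common dimension \<open>CARD('n)\<close> of the two subspaces. The lemmas
  \<open>orthonormal_basis_matrix_exists\<close>, \<open>subspace_dist_eq\<close> and \<open>subspace_dist_commute\<close>
  below show that the choice of the bases is possible and immaterial.
\<close>

definition subspace_dist ::
    "'n::finite itself \<Rightarrow> (real ^ 'N) set \<Rightarrow> (real ^ 'N) set \<Rightarrow> real" where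
  "subspace_dist T V W =
    (let Vb = (SOME B :: real ^ 'n ^ 'N. orthonormal_basis_matrix B V);
         Wb = (SOME B :: real ^ 'n ^ 'N. orthonormal_basis_matrix B W)
     in (norm (Vb - Wb ** transpose Wb ** Vb))\<^sup>2)"

definition basis_matrix :: "real ^ 'n ^ 'N \<Rightarrow> bool" where
  \<comment> \<open>\<open>columns U\<close> is a set, so injectivity is needed to exclude repeated columns\<close>
  "basis_matrix U \<longleftrightarrow> inj (\<lambda>j. column j U) \<and> independent (columns U)"

text \<open>The matrix whose column with index \<open>j\<close> is the canonical unit vector with index \<open>q j\<close>.\<close>

definition points_matrix :: "('m \<Rightarrow> 'N) \<Rightarrow> real ^ 'm ^ 'N" where
  "points_matrix q = (\<chi> i j. axis (q j) 1 $ i)"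

definition residual_at :: "real ^ 'w ^ 'N \<Rightarrow> 'N \<Rightarrow> real" where
  "residual_at R i = (norm (transpose R *v axis i 1))\<^sup>2"

definition index_ordering :: "(nat \<Rightarrow> 'N::finite) \<Rightarrow> bool" where
  "index_ordering l \<longleftrightarrow> bij_betw l {1..CARD('N)} UNIV"

text \<open>
  The columns of the sampling points matrix are indexed by the type \<open>'m\<close>, so the list of the
  first \<open>CARD('m)\<close> indices of the ordering is given up to the numbering of these columns.
\<close>

definition adaptive_sampling :: "real ^ 'w ^ 'N \<Rightarrow> ('m::finite \<Rightarrow> 'N) \<Rightarrow> bool" where
  "adaptive_sampling R s \<longleftrightarrow>
    (\<exists>l. index_ordering l \<and>
      (\<forall>i j. 1 \<le> i \<and> i \<le> j \<and> j \<le> CARD('N) \<longrightarrow> residual_at R (l j) \<le> residual_at R (l i)) \<and>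
      bij_betw s UNIV (l ` {1..CARD('m)}))"

text \<open>
  Matrices of the form \<open>\<alpha> \<beta>\<^sup>T\<close> with \<open>r\<close> columns in \<open>\<alpha>\<close> and \<open>\<beta>\<close>, whose rows outside of the sampling
  points vanish. The columns are numbered by \<open>0, \<dots>, r - 1\<close> rather than by a type so
  that \<open>r = 0\<close> is covered; then the matrix is zero.
\<close>

definition adeim_admissible :: "nat \<Rightarrow> ('m \<Rightarrow> 'N) \<Rightarrow> real ^ 'n ^ 'N \<Rightarrow> bool" where
  "adeim_admissible r s D \<longleftrightarrow>
    (\<exists>(\<alpha> :: 'N \<Rightarrow> nat \<Rightarrow> real) (\<beta> :: 'n \<Rightarrow> nat \<Rightarrow> real). D = (\<chi> i j. \<Sum>k<r. \<alpha> i k * \<beta> j k)) \<and>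
    (\<forall>i. i \<notin> range s \<longrightarrow> row i D = 0)"

definition adeim_update ::
    "nat \<Rightarrow> ('m::finite \<Rightarrow> 'N) \<Rightarrow> real ^ 'n ^ 'N \<Rightarrow> real ^ 'w ^ 'n \<Rightarrow> real ^ 'w ^ 'N \<Rightarrow> real ^ 'n ^ 'N \<Rightarrow> bool"
  where
  "adeim_update r s U C F D \<longleftrightarrow>
    adeim_admissible r s D \<and>
    (\<forall>D'. adeim_admissible r s D' \<longrightarrow>
      (norm (transpose (points_matrix s) ** ((U + D) ** C - F)))\<^sup>2
        \<le> (norm (transpose (points_matrix s) ** ((U + D') ** C - F)))\<^sup>2)"

definition full_rank_adeim_update ::
    "('m::finite \<Rightarrow> 'N) \<Rightarrow> real ^ 'n ^ 'N \<Rightarrow> real ^ 'w ^ 'n \<Rightarrow> real ^ 'w ^ 'N \<Rightarrow> real ^ 'n ^ 'N \<Rightarrow> bool"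
  where
  "full_rank_adeim_update s U C F D \<longleftrightarrow>
    adeim_update (rank (transpose (points_matrix s) ** (U ** C - F))) s U C F D"

definition singular_value :: "real ^ 'w ^ 'N \<Rightarrow> real \<Rightarrow> bool" where
  "singular_value A \<sigma> \<longleftrightarrow>
    \<sigma> \<ge> 0 \<and> (\<exists>v. v \<noteq> 0 \<and> (transpose A ** A) *v v = \<sigma>\<^sup>2 *\<^sub>R v)"

definition sigma_min :: "real ^ 'w ^ 'N \<Rightarrow> real" where
  "sigma_min A = (LEAST \<sigma>. \<sigma> \<noteq> 0 \<and> singular_value A \<sigma>)"

lemma orthonormal_basis_matrix_exists:
  fixes V :: "(real ^ 'N) set"
  assumes "subspace V" and "dim V = CARD('n::finite)"
  shows "\<exists>U :: real ^ 'n ^ 'N. orthonormal_basis_matrix U V"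
proof -
  obtain B where B: "B \<subseteq> V" "pairwise orthogonal B" "\<And>x. x \<in> B \<Longrightarrow> norm x = 1"
      "independent B" "card B = dim V" "span B = V"
    using orthonormal_basis_subspace[OF assms(1)] by metis
  have "finite B"
    using B(4) independent_imp_finite by blast
  then obtain f :: "'n \<Rightarrow> real ^ 'N" where f: "bij_betw f UNIV B"
    using B(5) assms(2) finite_same_card_bij[of "UNIV :: 'n set" B] by auto
  define U :: "real ^ 'n ^ 'N" where "U = (\<chi> i j. f j $ i)"
  have col: "column j U = f j" for j
    by (simp add: U_def column_def vec_eq_iff)
  have "inner (f i) (f j) = (if i = j then 1 else 0)" for i j
  proof (cases "i = j")
    case True
    then show ?thesis
      using B(3)[of "f i"] f by (auto simp: bij_betw_def dot_square_norm)
  next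
    case False
    then have "f i \<noteq> f j" "f i \<in> B" "f j \<in> B"
      using f by (auto simp: bij_betw_def inj_def)
    then show ?thesis
      using B(2) False by (auto simp: pairwise_def orthogonal_def)
  qed
  then have "transpose U ** U = mat 1"
    by (simp add: matrix_mult_transpose_dot_column col mat_def)
  moreover have "columns U = B"
    using f by (auto simp: columns_def col bij_betw_def)
  ultimately show ?thesis
    using B(6) by (auto simp: orthonormal_basis_matrix_def)
qed

lemma matrix_diff_ldistrib:
  fixes A :: "real ^ 'n ^ 'm" and B C :: "real ^ 'p ^ 'n"
  shows "A ** (B - C) = A ** B - A ** C"
  by (simp add: matrix_matrix_mult_def vec_eq_iff right_diff_distrib sum_subtractf)

lemma matrix_diff_rdistrib:
  fixes A B :: "real ^ 'n ^ 'm" and C :: "real ^ 'p ^ 'n"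
  shows "(A - B) ** C = A ** C - B ** C"
  by (simp add: matrix_matrix_mult_def vec_eq_iff left_diff_distrib sum_subtractf)

lemma norm_matrix_eq_trace:
  fixes A :: "real ^ 'n ^ 'm"
  shows "(norm A)\<^sup>2 = trace (A ** transpose A)"
  unfolding power2_norm_eq_inner
  by (simp add: trace_def matrix_mult_transpose_dot_row inner_vec_def row_def)

lemma orthonormal_basis_matrix_project:
  fixes U :: "real ^ 'n ^ 'N" and W :: "real ^ 'k ^ 'N"
  assumes "orthonormal_basis_matrix U V" and "columns W \<subseteq> V"
  shows "U ** transpose U ** W = W"
proof -
  have UU: "transpose U ** U = mat 1" and V: "span (columns U) = V"
    using assms(1) by (auto simp: orthonormal_basis_matrix_def)
  have fixed: "(U ** transpose U) *v y = y" if "y \<in> span (columns U)" for y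
    using that
  proof (induction rule: span_induct_alt)
    case base
    then show ?case by simp
  next
    case (step c x y)
    then obtain j where x: "x = U *v axis j 1"
      by (auto simp: columns_def matrix_vector_mult_basis)
    have "(U ** transpose U) *v x = (U ** (transpose U ** U)) *v axis j 1"
      by (simp add: x matrix_vector_mul_assoc matrix_mul_assoc)
    also have "\<dots> = x"
      by (simp add: UU x)
    finally show ?case
      using step by (simp add: matrix_vector_right_distrib matrix_vector_mult_scaleR)
  qed
  have "(U ** transpose U ** W) *v axis j 1 = W *v axis j 1" for j
  proof -
    have "column j W \<in> span (columns U)"
      using assms(2) V by (auto simp: columns_def)
    then show ?thesis
      using fixed[of "column j W"]
      by (metis matrix_vector_mul_assoc matrix_vector_mult_basis)
  qed
  then show ?thesis
    by (simp add: matrix_vector_mult_basis column_def vec_eq_iff)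
qed

lemma orthonormal_basis_matrix_projection_unique:
  fixes U U' :: "real ^ 'n ^ 'N"
  assumes "orthonormal_basis_matrix U V" and "orthonormal_basis_matrix U' V"
  shows "U ** transpose U = U' ** transpose U'"
proof -
  have sub: "columns U \<subseteq> V" "columns U' \<subseteq> V"
    using assms span_superset[of "columns U"] span_superset[of "columns U'"]
    unfolding orthonormal_basis_matrix_def by blast+
  note 1 = orthonormal_basis_matrix_project[OF assms(1) sub(2)]
  note 2 = orthonormal_basis_matrix_project[OF assms(2) sub(1)]
  have "U ** transpose U = transpose ((U' ** transpose U' ** U) ** transpose U)"
    by (simp only: 2 matrix_transpose_mul transpose_transpose)
  also have "\<dots> = (U ** transpose U ** U') ** transpose U'"
    by (simp only: matrix_transpose_mul matrix_mul_assoc transpose_transpose)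
  finally show ?thesis
    by (simp only: 1)
qed

lemma norm_projection_residual:
  fixes B U :: "real ^ 'n ^ 'N"
  assumes "transpose B ** B = mat 1" and "transpose U ** U = mat 1"
  shows "(norm (B - U ** transpose U ** B))\<^sup>2
    = real CARD('n) - trace ((B ** transpose B) ** (U ** transpose U))"
proof -
  define P where "P = U ** transpose U"
  define Q where "Q = B ** transpose B"
  have PP: "P ** P = P"
    unfolding P_def by (metis assms(2) matrix_mul_assoc matrix_mul_rid)
  have "transpose (B - P ** B) = transpose B - transpose B ** P"
  proof -
    have "transpose (B - P ** B) = transpose B - transpose (P ** B)"
      by (simp add: transpose_def vec_eq_iff)
    also have "transpose (P ** B) = transpose B ** P"
      by (simp add: P_def matrix_transpose_mul)
    finally show ?thesis .
  qed
  then have "(B - P ** B) ** transpose (B - P ** B)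
      = Q - Q ** P - (P ** Q - P ** (Q ** P))"
    by (simp add: Q_def matrix_diff_ldistrib matrix_diff_rdistrib matrix_mul_assoc)
  moreover have "trace (P ** (Q ** P)) = trace (Q ** P)"
    by (metis PP matrix_mul_assoc trace_mul_sym)
  moreover have "trace (P ** Q) = trace (Q ** P)"
    by (rule trace_mul_sym)
  moreover have "trace Q = real CARD('n)"
    unfolding Q_def by (subst trace_mul_sym) (simp add: assms(1) trace_I)
  ultimately show ?thesis
    by (simp add: norm_matrix_eq_trace trace_sub P_def Q_def)
qed

lemma subspace_dist_eq:
  fixes B U :: "real ^ 'n ^ 'N"
  assumes "orthonormal_basis_matrix B V" and "orthonormal_basis_matrix U W"
  shows "subspace_dist TYPE('n) V W = (norm (B - U ** transpose U ** B))\<^sup>2"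
proof -
  define B' :: "real ^ 'n ^ 'N" where "B' = (SOME B. orthonormal_basis_matrix B V)"
  define U' :: "real ^ 'n ^ 'N" where "U' = (SOME B. orthonormal_basis_matrix B W)"
  have B': "orthonormal_basis_matrix B' V" and U': "orthonormal_basis_matrix U' W"
    unfolding B'_def U'_def using assms by (metis someI)+
  have "subspace_dist TYPE('n) V W = (norm (B' - U' ** transpose U' ** B'))\<^sup>2"
    by (simp add: subspace_dist_def B'_def U'_def Let_def)
  also have "\<dots> = (norm (B - U ** transpose U ** B))\<^sup>2"
    using norm_projection_residual[of B' U'] norm_projection_residual[of B U] assms B' U'
      orthonormal_basis_matrix_projection_unique[OF B' assms(1)]
      orthonormal_basis_matrix_projection_unique[OF U' assms(2)]
    by (simp add: orthonormal_basis_matrix_def)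
  finally show ?thesis .
qed

lemma subspace_dist_commute:
  fixes V W :: "(real ^ 'N) set"
  assumes "subspace V" "dim V = CARD('n::finite)" and "subspace W" "dim W = CARD('n)"
  shows "subspace_dist TYPE('n) V W = subspace_dist TYPE('n) W V"
proof -
  obtain B U :: "real ^ 'n ^ 'N"
    where BU: "orthonormal_basis_matrix B V" "orthonormal_basis_matrix U W"
    using orthonormal_basis_matrix_exists assms by metis
  then show ?thesis
    using norm_projection_residual[of B U] norm_projection_residual[of U B]
      trace_mul_sym[of "B ** transpose B" "U ** transpose U"]
    by (simp add: subspace_dist_eq[OF BU] subspace_dist_eq[OF BU(2,1)]
        orthonormal_basis_matrix_def)
qed

end

theory Submission
  imports Defs
begin

text \<open>
  Since \<open>P\<^sup>T F\<close> has full rank, the row space of \<open>F\<close> equals that of \<open>C\<close>, so \<open>F = H C\<close> for some \<open>H\<close>.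
  Replacing the rows of \<open>U\<close> at the sampling points by those of \<open>H\<close> is an admissible update of rank
  \<open>rank (S\<^sup>T R)\<close> with zero objective, so every full-rank ADEIM update satisfies \<open>S\<^sup>T U' C = S\<^sup>T F\<close>,
  while the remaining rows of \<open>U' C - F\<close> are those of \<open>R\<close>. Since \<open>P\<^sup>T R = 0\<close>, moreover
  \<open>P\<^sup>T U' = P\<^sup>T U\<close>, hence \<open>U'\<close> has full rank. Writing \<open>F = W T\<close> with an orthonormal basis matrix \<open>W\<close>
  of the target space and \<open>\<Pi>\<close> for the orthogonal projection onto the span of \<open>U'\<close>, one gets
  \<open>\<sigma>\<^sub>m\<^sub>i\<^sub>n\<^sup>2 \<parallel>(1 - \<Pi>) W\<parallel>\<^sup>2 \<le> \<parallel>(1 - \<Pi>) F\<parallel>\<^sup>2 = \<parallel>(1 - \<Pi>) (F - U' C)\<parallel>\<^sup>2 \<le> \<parallel>F - U' C\<parallel>\<^sup>2\<close>, which is the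
  sum of the residuals off the sampling points. The latter is bounded by a geometric series because
  \<open>(m + k)\<^sup>a \<ge> m\<^sup>a + k\<close>.
\<close>

section \<open>Rows, Frobenius norm and rank factorization\<close>

lemma power2_norm_matrix:
  fixes A :: "real ^ 'n ^ 'm"
  shows "(norm A)\<^sup>2 = (\<Sum>i\<in>UNIV. (norm (A $ i))\<^sup>2)"
  by (simp add: norm_vec_def L2_set_def sum_nonneg)

lemma matrix_mult_row:
  fixes A :: "real ^ 'n ^ 'm" and B :: "real ^ 'p ^ 'n"
  shows "(A ** B) $ i = transpose B *v (A $ i)"
  by (simp add: vec_eq_iff matrix_matrix_mult_def matrix_vector_mult_def transpose_def mult.commute)

lemma points_matrix_row:
  fixes A :: "real ^ 'w ^ 'N"
  shows "(transpose (points_matrix q) ** A) $ k = A $ q k"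
proof -
  have "transpose (points_matrix q) $ k = axis (q k) 1"
    by (simp add: points_matrix_def transpose_def vec_eq_iff)
  then show ?thesis
    by (simp only: matrix_mult_row matrix_vector_mult_basis)
       (simp add: column_def transpose_def)
qed

lemma residual_at_eq: "residual_at R i = (norm (R $ i))\<^sup>2"
  by (simp add: residual_at_def matrix_vector_mult_basis column_def transpose_def)

text \<open>The columns are expanded in a basis of the column space; numbering it by
  \<open>{..<rank A}\<close> gives the sum format of \<open>adeim_admissible\<close>.\<close>

lemma rank_factorization:
  fixes A :: "real ^ 'n ^ 'm"
  shows "\<exists>\<alpha> \<beta>. A = (\<chi> i j. \<Sum>k<rank A. \<alpha> i k * \<beta> j k)"
proof -
  obtain B where B: "B \<subseteq> columns A" "independent B" "columns A \<subseteq> span B" "card B = rank A"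
    using basis_exists[of "columns A"] by (metis column_rank_def)
  have "finite B"
    using B(2) independent_imp_finite by blast
  then obtain f where f: "bij_betw f {..<rank A} B"
    using ex_bij_betw_nat_finite[of B] B(4) by (auto simp: atLeast0LessThan)
  have "\<exists>u. column j A = (\<Sum>b\<in>B. u b *\<^sub>R b)" for j
    using B(3) span_finite[OF \<open>finite B\<close>] by (fastforce simp: columns_def)
  then obtain u where u: "\<And>j. column j A = (\<Sum>b\<in>B. u j b *\<^sub>R b)"
    by metis
  have "A $ i $ j = (\<Sum>k<rank A. f k $ i * u j (f k))" for i j
  proof -
    have "A $ i $ j = column j A $ i"
      by (simp add: column_def)
    also have "\<dots> = (\<Sum>b\<in>B. u j b * b $ i)"
      by (subst u) simp
    also have "\<dots> = (\<Sum>k<rank A. u j (f k) * f k $ i)"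
      by (rule sum.reindex_bij_betw[OF f, symmetric])
    finally show ?thesis
      by (simp add: mult.commute)
  qed
  then have "A = (\<chi> i j. \<Sum>k<rank A. f k $ i * u j (f k))"
    by (simp add: vec_eq_iff)
  then show ?thesis
    by (intro exI[of _ "\<lambda>i k. f k $ i"] exI[of _ "\<lambda>j k. u j (f k)"])
qed

section \<open>Projections and the smallest nonzero singular value\<close>

text \<open>\<open>Q ** transpose Q\<close> is self-adjoint and idempotent, so Pythagoras applies to
  every column of \<open>X\<close>.\<close>

lemma norm_minus_projection_le:
  fixes Q :: "real ^ 'n ^ 'N" and X :: "real ^ 'w ^ 'N"
  assumes "transpose Q ** Q = mat 1"
  shows "norm (X - Q ** transpose Q ** X) \<le> norm X"
proof -
  define E where "E = Q ** transpose Q"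
  have idem: "E ** E = E"
    unfolding E_def by (metis assms matrix_mul_assoc matrix_mul_rid)
  have sym: "transpose E = E"
    by (simp add: E_def matrix_transpose_mul)
  have adj: "inner (E *v x) y = inner x (E *v y)" for x y
    using dot_lmul_matrix[of x E y] sym by (metis transpose_matrix_vector)
  have "norm (x - E *v x) \<le> norm x" for x
  proof -
    have "inner (E *v x) (E *v x) = inner x (E *v x)"
      by (simp add: adj matrix_vector_mul_assoc idem)
    then have "(norm (x - E *v x))\<^sup>2 = (norm x)\<^sup>2 - (norm (E *v x))\<^sup>2"
      by (simp add: power2_norm_eq_inner inner_diff inner_commute)
    then have "(norm (x - E *v x))\<^sup>2 \<le> (norm x)\<^sup>2"
      by simp
    then show ?thesis
      by (simp add: power2_le_iff_abs_le)
  qed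
  \<comment> \<open>The Frobenius norm is given by rows whereas \<open>E\<close> acts on columns,
    hence the passage to the transpose.\<close>
  then have "norm (transpose (X - E ** X) $ j) \<le> norm (transpose X $ j)" for j
  proof -
    have "transpose (X - E ** X) $ j = transpose X $ j - E *v (transpose X $ j)"
      by (simp add: vec_eq_iff transpose_def matrix_matrix_mult_def matrix_vector_mult_def)
    then show ?thesis
      by (simp add: \<open>\<And>x. norm (x - E *v x) \<le> norm x\<close>)
  qed
  then have "(norm (transpose (X - E ** X)))\<^sup>2 \<le> (norm (transpose X))\<^sup>2"
    unfolding power2_norm_matrix by (intro sum_mono power_mono) auto
  moreover have "norm (transpose Y) = norm Y" for Y :: "real ^ 'w ^ 'N"
  proof -
    have "(norm (transpose Y))\<^sup>2 = (norm Y)\<^sup>2"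
      by (metis norm_matrix_eq_trace trace_mul_sym transpose_transpose)
    then show ?thesis
      by (simp add: power2_eq_iff_nonneg)
  qed
  ultimately show ?thesis
    by (simp add: E_def power2_le_iff_abs_le)
qed

text \<open>A zero of a nonnegative quadratic form is a minimum, so the first-order term in the
  direction \<open>A *v x\<close> must vanish; it is a multiple of the squared norm of
  \<open>A *v x\<close>.\<close>

lemma psd_zero_imp_kernel:
  fixes A :: "real ^ 'n ^ 'n"
  assumes sym: "transpose A = A" and psd: "\<And>x. inner x (A *v x) \<ge> 0"
    and zero: "inner x (A *v x) = 0"
  shows "A *v x = 0"
proof -
  define y where "y = A *v x"
  have adj: "inner x (A *v y) = inner y y"
    using dot_lmul_matrix[of x A y] sym by (metis transpose_matrix_vector y_def)
  have q: "0 \<le> t * (2 * inner y y + t * inner y (A *v y))" for t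
  proof -
    have "inner (x + t *\<^sub>R y) (A *v (x + t *\<^sub>R y)) = t * (2 * inner y y + t * inner y (A *v y))"
      using zero adj
      by (simp add: matrix_vector_right_distrib matrix_vector_mult_scaleR inner_simps
          y_def[symmetric] inner_commute algebra_simps)
    then show ?thesis
      using psd[of "x + t *\<^sub>R y"] by simp
  qed
  have "inner y y = 0"
  proof (rule ccontr)
    assume "inner y y \<noteq> 0"
    then have p: "inner y y > 0" by simp
    define c where "c = inner y (A *v y)"
    have c: "c \<ge> 0" using psd c_def by auto
    \<comment> \<open>\<open>c + 1\<close> keeps the denominator positive, and
      \<open>- t * c\<close> is at most \<open>inner y y\<close>, so the bracket in \<open>q\<close>
      stays positive while \<open>t\<close> is negative.\<close>
    define t where "t = - (inner y y / (c + 1))"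
    have "t < 0" using p c by (simp add: t_def)
    moreover have "- t * c \<le> inner y y"
      using p c by (simp add: t_def field_simps)
    moreover from this have "2 * inner y y + t * c > 0"
      using p by linarith
    ultimately have "t * (2 * inner y y + t * c) < 0"
      by (intro mult_neg_pos)
    then show False using q[of t] c_def by simp
  qed
  then show ?thesis by (simp add: y_def)
qed

text \<open>The Gram matrix of \<open>Q ** T\<close> is \<open>transpose T ** T\<close>, which has
  the same nonzero eigenvalues as \<open>T ** transpose T\<close>. The latter is positive definite
  because \<open>T\<close> has a right inverse, so the value sought is the minimum of
  \<open>norm (transpose T *v x)\<close> over unit vectors.\<close>

lemma sigma_min_bound:
  fixes Q :: "real ^ 'n ^ 'N" and T :: "real ^ 'w ^ 'n" and G :: "real ^ 'n ^ 'w"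
  assumes Q: "transpose Q ** Q = mat 1" and G: "T ** G = mat 1"
  shows "sigma_min (Q ** T) > 0"
    and "(sigma_min (Q ** T))\<^sup>2 * (norm x)\<^sup>2 \<le> (norm (transpose T *v x))\<^sup>2"
proof -
  have inj: "x = 0" if "transpose T *v x = 0" for x
  proof -
    have "x = transpose (T ** G) *v x"
      by (simp add: G transpose_mat)
    also have "\<dots> = transpose G *v (transpose T *v x)"
      by (simp only: matrix_transpose_mul matrix_vector_mul_assoc)
    finally show ?thesis using that by simp
  qed
  have "sphere (0 :: real ^ 'n) 1 \<noteq> {}"
    by (metis norm_axis_1 mem_sphere_0 empty_iff)
  moreover have "continuous_on (sphere 0 1) (\<lambda>x. norm (transpose T *v x))"
    by (intro continuous_on_norm matrix_vector_mult_linear_continuous_on)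
  ultimately obtain x0 where x0: "norm x0 = 1"
      and min: "\<And>x. norm x = 1 \<Longrightarrow> norm (transpose T *v x0) \<le> norm (transpose T *v x)"
    using continuous_attains_inf[of "sphere (0 :: real ^ 'n) 1" "\<lambda>x. norm (transpose T *v x)"]
    by auto
  define \<sigma> where "\<sigma> = norm (transpose T *v x0)"
  have pos: "\<sigma> > 0"
    using inj[of x0] x0 by (auto simp: \<sigma>_def)
  have bound: "\<sigma>\<^sup>2 * (norm x)\<^sup>2 \<le> (norm (transpose T *v x))\<^sup>2" for x
  proof (cases "x = 0")
    case False
    have "\<sigma> \<le> norm (transpose T *v ((1 / norm x) *\<^sub>R x))"
      unfolding \<sigma>_def using False by (intro min) simp
    then have "\<sigma> * norm x \<le> norm (transpose T *v x)"
      using False by (simp add: matrix_vector_mult_scaleR field_simps)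
    then show ?thesis
      using pos power_mono[of "\<sigma> * norm x" _ 2] by (simp add: power_mult_distrib)
  qed simp
  have quad: "inner x ((T ** transpose T) *v x) = (norm (transpose T *v x))\<^sup>2" for x
    using dot_lmul_matrix[of x T "transpose T *v x"]
    by (simp add: matrix_vector_mul_assoc[symmetric] power2_norm_eq_inner)
  \<comment> \<open>\<open>A\<close> is positive semidefinite by \<open>bound\<close> and its form
    vanishes at the minimizer \<open>x0\<close>, which is therefore an eigenvector.\<close>
  define A where "A = T ** transpose T - \<sigma>\<^sup>2 *\<^sub>R mat 1"
  have Av: "A *v x = (T ** transpose T) *v x - \<sigma>\<^sup>2 *\<^sub>R x" for x
    by (simp add: A_def matrix_vector_mult_diff_rdistrib scaleR_matrix_vector_assoc[symmetric])
  have Aq: "inner x (A *v x) = (norm (transpose T *v x))\<^sup>2 - \<sigma>\<^sup>2 * (norm x)\<^sup>2" for x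
    by (simp add: Av inner_diff_right quad power2_norm_eq_inner)
  have "transpose A = A"
  proof -
    have "transpose A = transpose (T ** transpose T) - \<sigma>\<^sup>2 *\<^sub>R transpose (mat 1)"
      by (simp add: A_def transpose_def vec_eq_iff)
    then show ?thesis
      by (simp add: A_def matrix_transpose_mul)
  qed
  then have "A *v x0 = 0"
    by (rule psd_zero_imp_kernel) (use bound x0 in \<open>auto simp: Aq \<sigma>_def\<close>)
  then have eig: "(T ** transpose T) *v x0 = \<sigma>\<^sup>2 *\<^sub>R x0"
    by (simp add: Av)
  have QT: "transpose (Q ** T) ** (Q ** T) = transpose T ** T"
  proof -
    have "transpose (Q ** T) ** (Q ** T) = transpose T ** (transpose Q ** Q) ** T"
      by (simp only: matrix_transpose_mul matrix_mul_assoc)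
    then show ?thesis
      by (simp add: Q)
  qed
  have "singular_value (Q ** T) \<sigma>"
  proof -
    have "(transpose T ** T) *v (transpose T *v x0) = transpose T *v ((T ** transpose T) *v x0)"
      by (simp only: matrix_vector_mul_assoc matrix_mul_assoc)
    also have "\<dots> = \<sigma>\<^sup>2 *\<^sub>R (transpose T *v x0)"
      by (simp add: eig matrix_vector_mult_scaleR)
    finally show ?thesis
      unfolding singular_value_def QT using pos \<sigma>_def by fastforce
  qed
  moreover have "\<sigma> \<le> \<tau>" if \<tau>: "\<tau> \<noteq> 0" "singular_value (Q ** T) \<tau>" for \<tau>
  proof -
    obtain v where v: "v \<noteq> 0" "(transpose T ** T) *v v = \<tau>\<^sup>2 *\<^sub>R v" and "\<tau> \<ge> 0"
      using \<tau>(2) unfolding singular_value_def QT by auto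
    define y where "y = T *v v"
    have Ty: "transpose T *v y = \<tau>\<^sup>2 *\<^sub>R v"
      using v(2) by (simp add: y_def matrix_vector_mul_assoc)
    then have "y \<noteq> 0"
      using v(1) \<tau>(1) by auto
    have "(T ** transpose T) *v y = \<tau>\<^sup>2 *\<^sub>R y"
      unfolding matrix_vector_mul_assoc[symmetric] Ty by (simp add: matrix_vector_mult_scaleR y_def)
    then have "(norm (transpose T *v y))\<^sup>2 = \<tau>\<^sup>2 * (norm y)\<^sup>2"
      using quad[of y] by (simp add: power2_norm_eq_inner)
    with bound[of y] have "\<sigma>\<^sup>2 \<le> \<tau>\<^sup>2"
      using \<open>y \<noteq> 0\<close> by simp
    then show ?thesis
      using \<open>\<tau> \<ge> 0\<close> by (rule power2_le_imp_le)
  qed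
  \<comment> \<open>\<open>LEAST\<close> over the reals requires an attained minimum, here
    \<open>\<sigma>\<close>.\<close>
  ultimately have "sigma_min (Q ** T) = \<sigma>"
    unfolding sigma_min_def using pos by (intro Least_equality) auto
  with pos bound show "sigma_min (Q ** T) > 0"
    and "(sigma_min (Q ** T))\<^sup>2 * (norm x)\<^sup>2 \<le> (norm (transpose T *v x))\<^sup>2"
    by auto
qed

section \<open>Sorted residuals and the geometric tail\<close>

text \<open>Pigeonhole: the first \<open>i\<close> indices of \<open>l\<close> cannot all lie among
  the first \<open>i - 1\<close> of \<open>j\<close>, so one of them, \<open>l t\<close>, is
  \<open>j k\<close> with \<open>k \<ge> i\<close>.\<close>

lemma decreasing_rearrangement_bound:
  fixes f :: "'N::finite \<Rightarrow> real" and g :: "nat \<Rightarrow> real"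
  assumes j: "index_ordering (j :: nat \<Rightarrow> 'N)" and l: "index_ordering l"
    and sorted: "\<And>i k. 1 \<le> i \<Longrightarrow> i \<le> k \<Longrightarrow> k \<le> CARD('N) \<Longrightarrow> f (l k) \<le> f (l i)"
    and bound: "\<And>i. 1 \<le> i \<Longrightarrow> i \<le> CARD('N) \<Longrightarrow> f (j i) \<le> g i"
    and anti: "\<And>i k. 1 \<le> i \<Longrightarrow> i \<le> k \<Longrightarrow> g k \<le> g i"
    and i: "1 \<le> i" "i \<le> CARD('N)"
  shows "f (l i) \<le> g i"
proof -
  have inj: "inj_on j {1..CARD('N)}" "inj_on l {1..CARD('N)}"
    and surj: "j ` {1..CARD('N)} = UNIV"
    using j l by (auto simp: index_ordering_def bij_betw_def)
  have "card (l ` {1..i}) = i"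
    using card_image[OF inj_on_subset[OF inj(2)], of "{1..i}"] i by auto
  moreover have "card (j ` {1..<i}) < i"
    using card_image_le[of "{1..<i}" j] i by auto
  ultimately have "\<not> l ` {1..i} \<subseteq> j ` {1..<i}"
    by (metis card_mono finite_imageI finite_atLeastLessThan not_less)
  then obtain t where t: "1 \<le> t" "t \<le> i" "l t \<notin> j ` {1..<i}"
    by (auto simp: image_subset_iff simp del: One_nat_def)
  obtain k where k: "1 \<le> k" "k \<le> CARD('N)" "l t = j k"
    using surj by (metis UNIV_I atLeastAtMost_iff imageE)
  with t have "i \<le> k"
    by (metis atLeastLessThan_iff imageI not_less)
  have "f (l i) \<le> f (j k)"
    using sorted[of t i] t i k(3) by auto
  also have "\<dots> \<le> g k"
    using bound k by auto
  also have "\<dots> \<le> g i"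
    using anti i \<open>i \<le> k\<close> by auto
  finally show ?thesis .
qed

text \<open>Split off the factor with exponent \<open>a - 1\<close>: it is at least 1 at
  \<open>m\<close> and no smaller at \<open>m + k\<close>.\<close>

lemma powr_add_ge:
  fixes a :: real
  assumes "a > 1" and "m \<ge> 1"
  shows "real (m + k) powr a \<ge> real m powr a + real k"
proof -
  have split: "real x powr a = real x * real x powr (a - 1)" for x
    by (simp add: powr_mult_base)
  have "1 \<le> real m powr (a - 1)"
    using assms by (intro ge_one_powr_ge_zero) auto
  then have "real m powr a + real k \<le> real (m + k) * real m powr (a - 1)"
    unfolding split[of m] by (simp add: algebra_simps mult_left_mono[of 1 _ "real k", simplified])
  also have "\<dots> \<le> real (m + k) powr a"
    unfolding split[of "m + k"] using assms by (intro mult_left_mono powr_mono2) auto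
  finally show ?thesis .
qed

text \<open>By \<open>powr_add_ge\<close>, the term at \<open>i\<close> is smaller than the one at
  \<open>m\<close> by at least \<open>i - m\<close> factors \<open>exp (- c)\<close>.\<close>

lemma sum_exp_tail_le:
  fixes a c :: real
  assumes "a > 1" and "c > 0" and "m \<ge> 1"
  shows "(\<Sum>i=m+1..n. exp (- c * real i powr a)) \<le> exp (- c * real m powr a) / (1 - exp (- c))"
proof -
  have "(\<Sum>i=m+1..n. exp (- c * real i powr a))
      \<le> (\<Sum>i=m+1..n. exp (- c * real m powr a) * exp (- c) ^ (i - m))"
  proof (rule sum_mono)
    fix i assume "i \<in> {m+1..n}"
    then have "real i powr a \<ge> real m powr a + real (i - m)"
      using powr_add_ge[OF assms(1,3), of "i - m"] by simp
    then have "- c * real i powr a \<le> - c * real m powr a + real (i - m) * - c"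
      using assms(2) mult_left_mono[of _ _ c] by (fastforce simp: algebra_simps)
    then show "exp (- c * real i powr a) \<le> exp (- c * real m powr a) * exp (- c) ^ (i - m)"
      by (metis exp_add exp_le_cancel_iff exp_of_nat_mult)
  qed
  also have "\<dots> = exp (- c * real m powr a) * (\<Sum>i=m+1..n. exp (- c) ^ (i - m))"
    by (simp add: sum_distrib_left)
  also have "(\<Sum>i=m+1..n. exp (- c) ^ (i - m)) = (\<Sum>k\<in>(\<lambda>i. i - m) ` {m+1..n}. exp (- c) ^ k)"
    by (subst sum.reindex) (auto simp: inj_on_def)
  \<comment> \<open>The exponents on the left start at 1; admitting exponent 0 as well produces the
    constant found in \<open>c\<^sub>3\<close>.\<close>
  also have "\<dots> \<le> (\<Sum>k. exp (- c) ^ k)"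
    using assms(2) by (intro sum_le_suminf summable_geometric) auto
  also have "\<dots> = 1 / (1 - exp (- c))"
    using assms(2) by (intro suminf_geometric) auto
  finally show ?thesis
    by (simp add: mult_left_mono)
qed

section \<open>Exactness of the full-rank update\<close>

text \<open>The rank is the point: since \<open>C ** G = mat 1\<close>, the correction needed on the
  sampled rows is \<open>- (A ** G)\<close> with \<open>A\<close> the sampled residual, so it
  inherits a factorization with \<open>rank A\<close> terms.\<close>

lemma adeim_update_exact:
  fixes U D H :: "real ^ 'n ^ 'N" and C :: "real ^ 'w ^ 'n" and s :: "'m::finite \<Rightarrow> 'N"
  assumes "inj s" and G: "C ** G = mat 1" and F: "F = H ** C"
    and upd: "full_rank_adeim_update s U C F D"
  shows "((U + D) ** C) $ s k = F $ s k"
proof -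
  define A where "A = transpose (points_matrix s) ** (U ** C - F)"
  obtain \<alpha> \<beta> where fact: "A = (\<chi> i j. \<Sum>k<rank A. \<alpha> i k * \<beta> j k)"
    using rank_factorization by blast
  define D' :: "real ^ 'n ^ 'N" where "D' = (\<chi> i. if i \<in> range s then (H - U) $ i else 0)"
  have AG: "A ** G = transpose (points_matrix s) ** (U - H)"
  proof -
    have "A = transpose (points_matrix s) ** (U - H) ** C"
      by (simp add: A_def F matrix_diff_rdistrib[symmetric] matrix_mul_assoc)
    then show ?thesis
      by (simp add: matrix_mul_assoc[symmetric] G)
  qed
  \<comment> \<open>\<open>\<alpha>'\<close> moves the negated rows of \<open>\<alpha>\<close> to
    the sampling points; \<open>\<beta>'\<close> is \<open>transpose G\<close> applied to
    \<open>\<beta>\<close>.\<close>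
  define \<alpha>' where "\<alpha>' = (\<lambda>i k. if i \<in> range s then - \<alpha> (inv s i) k else 0)"
  define \<beta>' where "\<beta>' = (\<lambda>j k. \<Sum>l\<in>UNIV. G $ l $ j * \<beta> l k)"
  have D'_nth: "D' $ i $ j = (\<Sum>k<rank A. \<alpha>' i k * \<beta>' j k)" for i j
  proof (cases "i \<in> range s")
    case True
    then obtain q where q: "i = s q" by blast
    have "D' $ i $ j = - (A ** G) $ q $ j"
      by (simp add: D'_def q AG points_matrix_row)
    also have "(A ** G) $ q $ j = (\<Sum>l\<in>UNIV. (\<Sum>k<rank A. \<alpha> q k * \<beta> l k) * G $ l $ j)"
      by (subst fact) (simp add: matrix_matrix_mult_def)
    also have "\<dots> = (\<Sum>l\<in>UNIV. \<Sum>k<rank A. \<alpha> q k * (G $ l $ j * \<beta> l k))"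
      by (simp add: sum_distrib_left sum_distrib_right mult_ac)
    also have "\<dots> = (\<Sum>k<rank A. \<alpha> q k * \<beta>' j k)"
      by (subst sum.swap) (simp add: \<beta>'_def sum_distrib_left)
    finally show ?thesis
      using \<open>inj s\<close> by (simp add: \<alpha>'_def q sum_negf)
  qed (simp add: D'_def \<alpha>'_def)
  have "adeim_admissible (rank A) s D'"
    unfolding adeim_admissible_def
  proof (intro conjI exI)
    show "D' = (\<chi> i j. \<Sum>k<rank A. \<alpha>' i k * \<beta>' j k)"
      by (simp add: vec_eq_iff D'_nth)
    show "\<forall>i. i \<notin> range s \<longrightarrow> row i D' = 0"
      by (simp add: row_def D'_def vec_eq_iff)
  qed
  moreover have "transpose (points_matrix s) ** ((U + D') ** C - F) = 0"
  proof -
    have "(U + D') $ s q = H $ s q" for q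
      by (simp add: D'_def)
    then have "((U + D') ** C) $ s q = (H ** C) $ s q" for q
      by (simp only: matrix_mult_row)
    then have "(transpose (points_matrix s) ** ((U + D') ** C - F)) $ q = 0" for q
      by (simp only: points_matrix_row vector_minus_component F) simp
    then show ?thesis
      by (simp add: vec_eq_iff)
  qed
  ultimately have "(norm (transpose (points_matrix s) ** ((U + D) ** C - F)))\<^sup>2 \<le> 0"
    using upd unfolding full_rank_adeim_update_def adeim_update_def A_def[symmetric]
    by fastforce
  then have "transpose (points_matrix s) ** ((U + D) ** C - F) = 0"
    by simp
  then have "((U + D) ** C - F) $ s k = 0"
    by (metis points_matrix_row zero_index)
  then show ?thesis
    by simp
qed

section \<open>Distance to the adapted space\<close>

lemma orthonormal_basis_matrix_factor:
  fixes Q :: "real ^ 'n ^ 'N" and A :: "real ^ 'w ^ 'N"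
  assumes "orthonormal_basis_matrix Q V" and "columns A \<subseteq> V"
  shows "A = Q ** (transpose Q ** A)"
  using orthonormal_basis_matrix_project[OF assms] by (simp add: matrix_mul_assoc)

text \<open>Any \<open>C\<close> is allowed, because subtracting \<open>B ** C\<close> does not
  alter the part of \<open>F\<close> orthogonal to the column span of \<open>B\<close>.\<close>

lemma subspace_dist_le:
  fixes B :: "real ^ 'n ^ 'N" and F :: "real ^ 'w ^ 'N" and C :: "real ^ 'w ^ 'n"
  assumes "subspace V" and "dim V = CARD('n)" and "rank F = CARD('n)" and "columns F \<subseteq> V"
    and "rank B = CARD('n)"
  shows "sigma_min F > 0"
    and "(sigma_min F)\<^sup>2 * subspace_dist TYPE('n) V (span (columns B)) \<le> (norm (F - B ** C))\<^sup>2"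
proof -
  obtain W :: "real ^ 'n ^ 'N" where W: "orthonormal_basis_matrix W V"
    using orthonormal_basis_matrix_exists assms(1,2) by blast
  have "dim (span (columns B)) = CARD('n)"
    using assms(5) by (simp add: column_rank_def)
  then obtain Q :: "real ^ 'n ^ 'N" where Q: "orthonormal_basis_matrix Q (span (columns B))"
    using orthonormal_basis_matrix_exists[of "span (columns B)"] by auto
  have WW: "transpose W ** W = mat 1" and QQ: "transpose Q ** Q = mat 1"
    using W Q by (auto simp: orthonormal_basis_matrix_def)
  define T where "T = transpose W ** F"
  have F: "F = W ** T"
    unfolding T_def by (rule orthonormal_basis_matrix_factor[OF W assms(4)])
  \<comment> \<open>The rank of \<open>W ** T\<close>, which is \<open>F\<close>, cannot exceed that
    of \<open>T\<close>.\<close>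
  have "rank T = CARD('n)"
    using rank_mul_le_right[of W T] rank_bound[of T] assms(3) F by simp
  then obtain G where G: "T ** G = mat 1"
    using full_rank_surjective[of T] matrix_right_invertible_surjective[of T] by auto
  note sig = sigma_min_bound[OF WW G, folded F]
  show "sigma_min F > 0"
    by (rule sig(1))
  define M where "M = W - Q ** transpose Q ** W"
  have MT: "M ** T = (F - B ** C) - Q ** transpose Q ** (F - B ** C)"
  proof -
    have "Q ** transpose Q ** B = B"
      using orthonormal_basis_matrix_project[OF Q, of B] span_superset by blast
    then have "Q ** transpose Q ** (B ** C) = B ** C"
      by (simp add: matrix_mul_assoc)
    then have "(F - B ** C) - Q ** transpose Q ** (F - B ** C) = F - Q ** transpose Q ** F"
      by (simp add: matrix_diff_ldistrib)
    also have "\<dots> = M ** T"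
      by (simp add: M_def matrix_diff_rdistrib matrix_mul_assoc F)
    finally show ?thesis by simp
  qed
  \<comment> \<open>The rows of \<open>M ** T\<close> are \<open>transpose T\<close> applied to the
    rows of \<open>M\<close>, so the singular value bound is summed over rows.\<close>
  have "(sigma_min F)\<^sup>2 * (norm M)\<^sup>2 \<le> (norm (M ** T))\<^sup>2"
    unfolding power2_norm_matrix sum_distrib_left matrix_mult_row
    by (intro sum_mono sig(2))
  also have "\<dots> \<le> (norm (F - B ** C))\<^sup>2"
    unfolding MT using norm_minus_projection_le[OF QQ] by (intro power_mono) auto
  finally show "(sigma_min F)\<^sup>2 * subspace_dist TYPE('n) V (span (columns B)) \<le> (norm (F - B ** C))\<^sup>2"
    by (simp add: subspace_dist_eq[OF W Q] M_def)
qed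

lemma adeim_subspace_dist_bound:
  fixes U D :: "real ^ 'n ^ 'N" and P :: "real ^ 'n ^ 'N" and C :: "real ^ 'w ^ 'n"
    and s :: "'m::finite \<Rightarrow> 'N"
  assumes P: "P = points_matrix p"
    and inv: "invertible (transpose P ** U)"
    and V: "subspace V" "dim V = CARD('n)"
    and F: "rank F = CARD('n)" "columns F \<subseteq> V" "rank (transpose P ** F) = CARD('n)"
    and C: "C = matrix_inv (transpose P ** U) ** (transpose P ** F)"
    and "inj s" and upd: "full_rank_adeim_update s U C F D"
  shows "sigma_min F > 0"
    and "(sigma_min F)\<^sup>2 * subspace_dist TYPE('n) V (span (columns (U + D)))
      \<le> (\<Sum>i\<in>- range s. residual_at (U ** C - F) i)"
proof -
  define K where "K = transpose P ** U"
  have KK: "K ** matrix_inv K = mat 1" "matrix_inv K ** K = mat 1"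
    using someI_ex[of "\<lambda>B. K ** B = mat 1 \<and> B ** K = mat 1"] inv
    unfolding invertible_def matrix_inv_def K_def by auto
  have PUC: "transpose P ** (U ** C) = transpose P ** F"
    by (metis C K_def KK(1) matrix_mul_assoc matrix_mul_lid)
  obtain G0 where G0: "transpose P ** F ** G0 = mat 1"
    using F(3) full_rank_surjective matrix_right_invertible_surjective by metis
  \<comment> \<open>\<open>C\<close> is the inverse of \<open>K\<close> times
    \<open>transpose P ** F\<close>; the right inverses of the factors are multiplied in reverse
    order.\<close>
  define G where "G = G0 ** K"
  have G: "C ** G = mat 1"
  proof -
    have "C ** G = matrix_inv K ** (transpose P ** F ** G0) ** K"
      by (simp add: C G_def K_def matrix_mul_assoc)
    then show ?thesis
      by (simp add: G0 KK)
  qed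
  obtain W :: "real ^ 'n ^ 'N" where W: "orthonormal_basis_matrix W V"
    using orthonormal_basis_matrix_exists V by blast
  define T where "T = transpose W ** F"
  have FT: "F = W ** T"
    unfolding T_def by (rule orthonormal_basis_matrix_factor[OF W F(2)])
  \<comment> \<open>\<open>P\<^sup>T W\<close> is invertible because \<open>P\<^sup>T F = (P\<^sup>T W) T\<close> has full rank; hence \<open>T\<close>, and with it \<open>F\<close>,
    factors through \<open>P\<^sup>T F = (P\<^sup>T U) C\<close>.\<close>
  have "(transpose P ** W) ** (T ** G0) = mat 1"
    using G0 FT by (metis matrix_mul_assoc)
  then have "(T ** G0) ** (transpose P ** W) = mat 1"
    using matrix_left_right_inverse by blast
  then have "T = (T ** G0) ** (transpose P ** F)"
    by (metis FT matrix_mul_assoc matrix_mul_lid)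
  then have "F = (W ** (T ** G0) ** K) ** C"
    by (metis FT K_def PUC matrix_mul_assoc)
  then have exact: "((U + D) ** C) $ s k = F $ s k" for k
    using adeim_update_exact[OF \<open>inj s\<close> G _ upd] by blast
  have D0: "D $ i = 0" if "i \<notin> range s" for i
    using upd that
    by (simp add: full_rank_adeim_update_def adeim_update_def adeim_admissible_def row_def
        vec_lambda_eta)
  have rows: "((U + D) ** C - F) $ i = (if i \<in> range s then 0 else (U ** C - F) $ i)" for i
  proof (cases "i \<in> range s")
    case True
    then show ?thesis
      using exact by (auto simp only: vector_minus_component if_True diff_self)
  next
    case False
    then have "((U + D) ** C) $ i = (U ** C) $ i"
      unfolding matrix_mult_row by (simp only: vector_add_component D0 add_0_right not_False_eq_True)
    with False show ?thesis
      by simp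
  qed
  \<comment> \<open>If \<open>p k\<close> is sampled, exactness gives zero; if not, the row keeps
    its old residual, which vanishes at interpolation points.\<close>
  have "((U + D) ** C - F) $ p k = 0" for k
  proof -
    have "(U ** C - F) $ p k = 0"
      using arg_cong[OF PUC, of "\<lambda>A. A $ k"] by (simp only: P points_matrix_row vector_minus_component diff_self)
    then show ?thesis
      unfolding rows by simp
  qed
  then have "transpose P ** ((U + D) ** C - F) = 0"
    by (subst vec_eq_iff) (simp only: P points_matrix_row zero_index simp_thms)
  then have "transpose P ** (U + D) ** C = transpose P ** U ** C"
    using PUC by (simp only: matrix_diff_ldistrib matrix_mul_assoc right_minus_eq)
  then have "transpose P ** (U + D) = K"
    by (metis G K_def matrix_mul_assoc matrix_mul_rid)
  moreover have "rank K = CARD('n)"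
    using KK(2) full_rank_injective matrix_left_invertible_injective by metis
  \<comment> \<open>Full rank gives the adapted span dimension \<open>CARD('n)\<close>, so that the
    \<open>SOME\<close> in \<open>subspace_dist\<close> does choose an orthonormal basis
    matrix.\<close>
  ultimately have "rank (U + D) = CARD('n)"
    using rank_mul_le_right[of "transpose P" "U + D"] rank_bound[of "U + D"] by simp
  note dist = subspace_dist_le[OF V F(1,2) this]
  show "sigma_min F > 0"
    by (rule dist(1))
  have "(norm (F - (U + D) ** C))\<^sup>2 = (norm ((U + D) ** C - F))\<^sup>2"
    by (simp add: norm_minus_commute)
  also have "\<dots> = (\<Sum>i\<in>- range s. residual_at (U ** C - F) i)"
    unfolding power2_norm_matrix rows
    by (rule sum.mono_neutral_cong_right) (auto simp: residual_at_eq)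
  finally show "(sigma_min F)\<^sup>2 * subspace_dist TYPE('n) V (span (columns (U + D)))
      \<le> (\<Sum>i\<in>- range s. residual_at (U ** C - F) i)"
    using dist(2)[of C] by simp
qed

section \<open>Residuals off the sampling points and the final estimate\<close>

text \<open>The unsampled indices fill the positions after \<open>CARD('m)\<close> in the decreasing
  ordering \<open>l\<close>. The rearrangement bound carries the decay from \<open>j\<close>, which
  need not be sorted, over to \<open>l\<close>.\<close>

lemma adaptive_sampling_tail_le:
  fixes R :: "real ^ 'w ^ 'N" and s :: "'m::finite \<Rightarrow> 'N" and j :: "nat \<Rightarrow> 'N"
  assumes s: "adaptive_sampling R s" and j: "index_ordering j" and m: "CARD('m) \<le> CARD('N)"
    and bound: "\<And>i. 1 \<le> i \<Longrightarrow> i \<le> CARD('N) \<Longrightarrow> residual_at R (j i) \<le> g i"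
    and anti: "\<And>i k. 1 \<le> i \<Longrightarrow> i \<le> k \<Longrightarrow> g k \<le> g i"
  shows "inj s" and "(\<Sum>i\<in>- range s. residual_at R i) \<le> (\<Sum>i=CARD('m)+1..CARD('N). g i)"
proof -
  obtain l where l: "index_ordering l"
    and sorted: "\<And>i k. 1 \<le> i \<Longrightarrow> i \<le> k \<Longrightarrow> k \<le> CARD('N) \<Longrightarrow> residual_at R (l k) \<le> residual_at R (l i)"
    and sl: "bij_betw s UNIV (l ` {1..CARD('m)})"
    using s unfolding adaptive_sampling_def by blast
  show "inj s"
    using sl by (simp add: bij_betw_def)
  have inj: "inj_on l {1..CARD('N)}" and surj: "l ` {1..CARD('N)} = UNIV"
    using l by (auto simp: index_ordering_def bij_betw_def)
  have "{CARD('m)+1..CARD('N)} = {1..CARD('N)} - {1..CARD('m)}"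
    by auto
  moreover have "range s = l ` {1..CARD('m)}"
    using sl by (simp add: bij_betw_def)
  ultimately have "- range s = l ` {CARD('m)+1..CARD('N)}"
    using inj_on_image_set_diff[OF inj, of "{1..CARD('N)}" "{1..CARD('m)}"] surj m by auto
  then have "(\<Sum>i\<in>- range s. residual_at R i) = (\<Sum>i=CARD('m)+1..CARD('N). residual_at R (l i))"
    using inj_on_subset[OF inj, of "{CARD('m)+1..CARD('N)}"] by (simp add: sum.reindex)
  also have "\<dots> \<le> (\<Sum>i=CARD('m)+1..CARD('N). g i)"
    by (intro sum_mono decreasing_rearrangement_bound[OF j l sorted bound anti]) auto
  finally show "(\<Sum>i\<in>- range s. residual_at R i) \<le> (\<Sum>i=CARD('m)+1..CARD('N). g i)" .
qed

theorem proposition2: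
  fixes U :: "real ^ 'n ^ 'N"
    and p :: "'n \<Rightarrow> 'N"
    and P :: "real ^ 'n ^ 'N"
    and Vbar :: "(real ^ 'N) set"
    and F R :: "real ^ 'w ^ 'N"
    and C :: "real ^ 'w ^ 'n"
    and j :: "nat \<Rightarrow> 'N"
    and s :: "'m::finite \<Rightarrow> 'N"
    and D U' :: "real ^ 'n ^ 'N"
    and a c\<^sub>1 c\<^sub>2 c\<^sub>3 :: real
  assumes "basis_matrix U"
    and "inj p" and "P = points_matrix p"
    and "invertible (transpose P ** U)"
    and "subspace Vbar" and "dim Vbar = CARD('n)"
    and "rank F = CARD('n)" and "columns F \<subseteq> Vbar"
    and "rank (transpose P ** F) = CARD('n)"
    and "C = matrix_inv (transpose P ** U) ** (transpose P ** F)"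
    and "R = U ** C - F"
    and "a > 1" and "c\<^sub>1 > 0" and "c\<^sub>2 > 0"
    and "index_ordering j"
    and "\<And>i. 1 \<le> i \<Longrightarrow> i \<le> CARD('N) \<Longrightarrow>
          residual_at R (j i) \<le> c\<^sub>1 * exp (- c\<^sub>2 * real i powr a)"
    and "CARD('n) < CARD('m)" and "CARD('m) \<le> CARD('N)"
    and "adaptive_sampling R s"
    and "full_rank_adeim_update s U C F D"
    and "U' = U + D"
    and "c\<^sub>3 = c\<^sub>1 / ((1 - exp (- c\<^sub>2)) * (sigma_min F)\<^sup>2)"
  shows "subspace_dist TYPE('n) Vbar (span (columns U')) \<le> c\<^sub>3 * exp (- c\<^sub>2 * real CARD('m) powr a)
    \<and> (\<forall>\<epsilon>>0.
        real CARD('m) \<ge> min (real CARD('N))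
          (if \<epsilon> > c\<^sub>3 then 0 else (- (1 / c\<^sub>2) * ln (\<epsilon> / c\<^sub>3)) powr (1 / a))
        \<longrightarrow> subspace_dist TYPE('n) Vbar (span (columns U')) \<le> \<epsilon>)"
proof -
  define d where "d = subspace_dist TYPE('n) Vbar (span (columns U'))"
  define g where "g i = c\<^sub>1 * exp (- c\<^sub>2 * real i powr a)" for i
  define m where "m = CARD('m)"
  have m1: "1 \<le> m"
    by (simp add: m_def Suc_le_eq)
  have anti: "g k \<le> g i" if "1 \<le> i" "i \<le> k" for i k
    using that assms(12-14) by (simp add: g_def powr_mono2)
  note samp = adaptive_sampling_tail_le[where g = g, OF assms(19,15,18) _ anti]
  have inj: "inj s"
    using samp(1) assms(16) by (simp add: g_def)
  note base = adeim_subspace_dist_bound[OF assms(3-10) inj assms(20)]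
  have \<sigma>: "sigma_min F > 0"
    by (rule base(1))
  have "(sigma_min F)\<^sup>2 * d \<le> (\<Sum>i=m+1..CARD('N). g i)"
    using base(2) samp(2) assms(16) unfolding d_def m_def assms(21)
    by (force simp: g_def assms(11))
  \<comment> \<open>The bound by the finite sum is kept for the case that every index is sampled:
    the sum is then empty, while the exponential bound stays positive.\<close>
  also note tail = calculation
  have "(\<Sum>i=m+1..CARD('N). g i) \<le> c\<^sub>1 * (exp (- c\<^sub>2 * real m powr a) / (1 - exp (- c\<^sub>2)))"
    unfolding g_def sum_distrib_left[symmetric]
    using sum_exp_tail_le[OF \<open>a > 1\<close> \<open>c\<^sub>2 > 0\<close> m1] \<open>c\<^sub>1 > 0\<close> by (intro mult_left_mono) auto
  finally have "d \<le> c\<^sub>1 * (exp (- c\<^sub>2 * real m powr a) / (1 - exp (- c\<^sub>2))) / (sigma_min F)\<^sup>2"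
    using \<sigma> by (subst pos_le_divide_eq) (simp_all only: mult.commute zero_less_power)
  then have main: "d \<le> c\<^sub>3 * exp (- c\<^sub>2 * real m powr a)"
    by (simp add: assms(22))
  have "exp (- c\<^sub>2) < 1"
    using \<open>c\<^sub>2 > 0\<close> by simp
  then have c3: "c\<^sub>3 > 0"
    using \<sigma> \<open>c\<^sub>1 > 0\<close> unfolding assms(22) by (intro divide_pos_pos mult_pos_pos) auto
  have "d \<le> \<epsilon>" if \<epsilon>: "\<epsilon> > 0" and cond: "min (real CARD('N))
      (if \<epsilon> > c\<^sub>3 then 0 else (- (1 / c\<^sub>2) * ln (\<epsilon> / c\<^sub>3)) powr (1 / a)) \<le> real m" for \<epsilon>
  proof (cases "CARD('N) \<le> m")
    case True
    with tail have "(sigma_min F)\<^sup>2 * d \<le> 0"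
      by simp
    then have "d \<le> 0"
      using \<sigma> by (simp add: mult_le_0_iff)
    with \<epsilon> show ?thesis by simp
  next
    case False
    note main
    also have "c\<^sub>3 * exp (- c\<^sub>2 * real m powr a) \<le> \<epsilon>"
    proof (cases "\<epsilon> > c\<^sub>3")
      case True
      have "c\<^sub>3 * exp (- c\<^sub>2 * real m powr a) \<le> c\<^sub>3"
        using c3 \<open>c\<^sub>2 > 0\<close> by (simp add: mult_left_le)
      with True show ?thesis by simp
    next
      case le: False
      define x where "x = - (1 / c\<^sub>2) * ln (\<epsilon> / c\<^sub>3)"
      \<comment> \<open>Nonnegativity is what lets the powers \<open>1 / a\<close> and
        \<open>a\<close> cancel below.\<close>
      have x: "x \<ge> 0"
        using le \<epsilon> c3 \<open>c\<^sub>2 > 0\<close> by (simp add: x_def mult_nonneg_nonpos divide_nonpos_pos ln_le_zero_iff)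
      have "x powr (1 / a) \<le> real m"
        using cond le False by (simp add: x_def)
      then have "(x powr (1 / a)) powr a \<le> real m powr a"
        using \<open>a > 1\<close> by (intro powr_mono2) auto
      then have "x \<le> real m powr a"
        using x \<open>a > 1\<close> by (simp add: powr_powr)
      then have "c\<^sub>2 * x \<le> c\<^sub>2 * real m powr a"
        using \<open>c\<^sub>2 > 0\<close> by simp
      then have "- c\<^sub>2 * real m powr a \<le> ln (\<epsilon> / c\<^sub>3)"
        using \<open>c\<^sub>2 > 0\<close> by (simp add: x_def)
      then have "exp (- c\<^sub>2 * real m powr a) \<le> \<epsilon> / c\<^sub>3"
        using \<epsilon> c3 by (simp add: ln_ge_iff)
      then show ?thesis
        using c3 by (simp add: field_simps)
    qed
    finally show ?thesis .
  qed
  with main show ?thesis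
    unfolding d_def m_def by blast
qed

end
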